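(* Let $f:\mathbb{R}^N\to\mathbb{R}$ be convex and differentiable, let $\hat S$ be a proper sampling with probability vector $p=(p_1,\dots,p_n)$, and let $v\in\mathbb{R}^n_{++}$ be such that $(f,\hat S)\sim ESO(v)$. For any optimal solution $x_*$ of the problem of minimizing $f$ over $\mathbb{R}^N$, the output of the Accelerated Parallel Coordinate Descent (APCD) algorithm satisfies, for all $k\ge1$, $$\mathbf{E}[f(x_k)]-f(x_* )\le\frac{2\|x_0-x_*\|^2_{v\circ p^{-2}}}{(k+1)^2}.$$ In particular, for $\epsilon>0$ and $k\ge 1$, if $$k\ge\sqrt{\frac{2\|x_0-x_*\|^2_{v\circ p^{-2}}}{\epsilon}}-1,$$ then $\mathbf{E}[f(x_k)]-f(x_* )\le\epsilon$.
   Context: Block structure: $\mathbb{R}^N=\mathbb{R}^{N_1}\times\dots\times\mathbb{R}^{N_n}$, $[n]=\{1,\dots,n\}$; $x^i\in\mathbb{R}^{N_i}$ is the $i$th block of $x\in\mathbb{R}^N$, and $U_i$ is the $N\times N_i$ column submatrix of the identity with $x^i=U_i^\top x$. For $S\subseteq[n]$, $h_{[S]}=\sum_{i\in S}U_ih^i$. $\nabla_i f(x)=U_i^\top\nabla f(x)$. $\langle\cdot,\cdot\rangle$ is the standard inner product. For each $i$, $B_i$ is a fixed (symmetric) positive definite $N_i\times N_i$ matrix and $\|x^i\|_i^2=\langle B_ix^i,x^i\rangle$. For $w\in\mathbb{R}^n_{++}$ (vectors with positive entries): $\langle x,y\rangle_w=\sum_i w_i\langle x^i,y^i\rangle$ and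 $\|x\|_w^2=\sum_i w_i\|x^i\|_i^2$. For vectors in $\mathbb{R}^n$: $\circ$ is the elementwise product, and $p^{-1},p^{-2}$ are elementwise powers. For $u\in\mathbb{R}^n$, $x\in\mathbb{R}^N$: $u\cdot x=\sum_i u_iU_ix^i$. Sampling: a sampling $\hat S$ is a random subset of $[n]$; $p_i=\mathrm{Prob}(i\in\hat S)$; it is proper if $p_i>0$ for all $i$. ESO: $(f,\hat S)\sim ESO(v)$ means that for all $x,h\in\mathbb{R}^N$, $\mathbf{E}[f(x+h_{[\hat S]})]\le f(x)+\langle\nabla f(x),h\rangle_p+\frac12\|h\|^2_{v\circ p}$. APCD algorithm: choose $x_0\in\mathbb{R}^N$, set $z_0=x_0$ and $\theta_0=1$. For $k\ge0$: $y_k=(1-\theta_k)x_k+\theta_kz_k$; draw a random set $S_k$ with the distribution of $\hat S$, independently of the past; set $z_{k+1}^i=z_k^i-\frac{p_i}{v_i\theta_k}B_i^{-1}\nabla_if(y_k)$ for $i\in S_k$ and $z_{k+1}^i=z_k^i$ for $i\notin S_k$; set $x_{k+1}=y_k+\theta_kp^{-1}\cdot(z_{k+1}-z_k)$ and $\theta_{k+1}=\frac12\big(\sqrt{\theta_k^4+4\theta_k^2}-\theta_k^2\big)$. *)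

theory Defs
  imports "HOL-Probability.Probability"
begin

text \<open>
  The coordinates of \<open>\<real>\<^sup>N\<close> are indexed by a finite type \<open>'N\<close>, the blocks by a finite type \<open>'n\<close>,
  and \<open>b :: 'N \<Rightarrow> 'n\<close> assigns to each coordinate the block it belongs to, so that \<open>N\<^sub>i\<close> is the number
  of \<open>j\<close> with \<open>b j = i\<close>. Types cannot depend on \<open>i\<close>; hence a block vector in the \<open>i\<close>th factor is
  represented by its zero extension to \<open>\<real>\<^sup>N\<close>, and an \<open>N\<^sub>i \<times> N\<^sub>i\<close> matrix by its zero extension to an
  \<open>N \<times> N\<close> matrix.
\<close>

definition block :: "('N::finite \<Rightarrow> 'n) \<Rightarrow> 'n \<Rightarrow> real^'N \<Rightarrow> real^'N" where
  "block b i x = (\<chi> j. if b j = i then x $ j else 0)"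

definition block_matrix :: "('N::finite \<Rightarrow> 'n) \<Rightarrow> 'n \<Rightarrow> real^'N^'N \<Rightarrow> bool" where
  "block_matrix b i A \<longleftrightarrow> (\<forall>j k. \<not> (b j = i \<and> b k = i) \<longrightarrow> A $ j $ k = 0)"

definition block_id :: "('N::finite \<Rightarrow> 'n) \<Rightarrow> 'n \<Rightarrow> real^'N^'N" where
  "block_id b i = (\<chi> j k. if j = k \<and> b j = i then 1 else 0)"

text \<open>The inverse as an \<open>N\<^sub>i \<times> N\<^sub>i\<close> matrix: the zero extension is singular as an \<open>N \<times> N\<close> matrix.\<close>

definition block_inv :: "('N::finite \<Rightarrow> 'n) \<Rightarrow> 'n \<Rightarrow> real^'N^'N \<Rightarrow> real^'N^'N" where
  "block_inv b i A =
     (THE A'. block_matrix b i A' \<and> A ** A' = block_id b i \<and> A' ** A = block_id b i)"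

definition block_pos_def :: "('N::finite \<Rightarrow> 'n) \<Rightarrow> 'n \<Rightarrow> real^'N^'N \<Rightarrow> bool" where
  "block_pos_def b i A \<longleftrightarrow>
     block_matrix b i A \<and> transpose A = A \<and>
     (\<forall>x. block b i x \<noteq> 0 \<longrightarrow> (A *v block b i x) \<bullet> block b i x > 0)"

definition block_restrict :: "('N::finite \<Rightarrow> 'n) \<Rightarrow> 'n set \<Rightarrow> real^'N \<Rightarrow> real^'N" where
  "block_restrict b S h = (\<Sum>i\<in>S. block b i h)"

definition block_scale :: "('N::finite \<Rightarrow> 'n::finite) \<Rightarrow> real^'n \<Rightarrow> real^'N \<Rightarrow> real^'N" where
  "block_scale b u x = (\<Sum>i\<in>UNIV. u $ i *\<^sub>R block b i x)"

definition winner :: "('N::finite \<Rightarrow> 'n::finite) \<Rightarrow> real^'n \<Rightarrow> real^'N \<Rightarrow> real^'N \<Rightarrow> real" where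
  "winner b w x y = (\<Sum>i\<in>UNIV. w $ i * (block b i x \<bullet> block b i y))"

definition wnorm_sq ::
  "('N::finite \<Rightarrow> 'n::finite) \<Rightarrow> ('n \<Rightarrow> real^'N^'N) \<Rightarrow> real^'n \<Rightarrow> real^'N \<Rightarrow> real" where
  "wnorm_sq b B w x = (\<Sum>i\<in>UNIV. w $ i * ((B i *v block b i x) \<bullet> block b i x))"

text \<open>Elementwise powers; the elementwise product is multiplication on \<^typ>\<open>real^'n\<close>.\<close>

definition vec_powi :: "real^'n \<Rightarrow> int \<Rightarrow> real^'n" where
  "vec_powi u m = (\<chi> i. u $ i powi m)"

definition grad :: "(real^'N::finite \<Rightarrow> real) \<Rightarrow> real^'N \<Rightarrow> real^'N" where
  "grad f x = (THE g. GDERIV f x :> g)"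

text \<open>A sampling is given by its law, a probability mass function on the subsets of the finite \<open>'n\<close>.\<close>

definition sampling_prob :: "'n::finite set pmf \<Rightarrow> real^'n" where
  "sampling_prob D = (\<chi> i. measure_pmf.prob D {S. i \<in> S})"

definition proper_sampling :: "'n::finite set pmf \<Rightarrow> bool" where
  "proper_sampling D \<longleftrightarrow> (\<forall>i. sampling_prob D $ i > 0)"

definition ESO ::
  "('N::finite \<Rightarrow> 'n::finite) \<Rightarrow> ('n \<Rightarrow> real^'N^'N) \<Rightarrow> (real^'N \<Rightarrow> real) \<Rightarrow> 'n set pmf \<Rightarrow> real^'n \<Rightarrow> bool"
where
  "ESO b B f D v \<longleftrightarrow>
     (\<forall>x h. measure_pmf.expectation D (\<lambda>S. f (x + block_restrict b S h))
        \<le> f x + winner b (sampling_prob D) (grad f x) h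
          + 1/2 * wnorm_sq b B (v * sampling_prob D) h)"

primrec theta :: "nat \<Rightarrow> real" where
  "theta 0 = 1"
| "theta (Suc k) = 1/2 * (sqrt (theta k ^ 4 + 4 * theta k ^ 2) - theta k ^ 2)"

text \<open>
  The pairs \<open>(x\<^sub>k, z\<^sub>k)\<close> along a realisation \<open>S\<close> of the sequence of random sets;
  \<open>p\<close> is the probability vector of the sampling.
\<close>

primrec apcd ::
  "('N::finite \<Rightarrow> 'n::finite) \<Rightarrow> ('n \<Rightarrow> real^'N^'N) \<Rightarrow> (real^'N \<Rightarrow> real) \<Rightarrow> real^'n \<Rightarrow> real^'n
    \<Rightarrow> real^'N \<Rightarrow> (nat \<Rightarrow> 'n set) \<Rightarrow> nat \<Rightarrow> (real^'N) \<times> (real^'N)"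
where
  "apcd b B f p v x0 S 0 = (x0, x0)"
| "apcd b B f p v x0 S (Suc k) =
     (let (x, z) = apcd b B f p v x0 S k;
          y = (1 - theta k) *\<^sub>R x + theta k *\<^sub>R z;
          z' = (\<Sum>i\<in>UNIV. if i \<in> S k
                  then block b i z - (p $ i / (v $ i * theta k)) *\<^sub>R
                         (block_inv b i (B i) *v block b i (grad f y))
                  else block b i z);
          x' = y + theta k *\<^sub>R block_scale b (vec_powi p (-1)) (z' - z)
      in (x', z'))"

definition apcd_x ::
  "('N::finite \<Rightarrow> 'n::finite) \<Rightarrow> ('n \<Rightarrow> real^'N^'N) \<Rightarrow> (real^'N \<Rightarrow> real) \<Rightarrow> real^'n \<Rightarrow> real^'n
    \<Rightarrow> real^'N \<Rightarrow> (nat \<Rightarrow> 'n set) \<Rightarrow> nat \<Rightarrow> real^'N"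
where
  "apcd_x b B f p v x0 S k = fst (apcd b B f p v x0 S k)"

end

theory Submission
  imports Defs
begin

text \<open>
  The proof is a Lyapunov argument for the quantity \<open>f(x) - f(x\<^sub>*) + \<theta>\<^sup>2/2 \<parallel>z - x\<^sub>*\<parallel>\<^sup>2\<close>, the norm being the
  one with weights \<open>v\<^sub>i / p\<^sub>i\<^sup>2\<close>.

  Fix the state \<open>(x, z)\<close> before a step, let \<open>y = (1 - \<theta>) x + \<theta> z\<close> and \<open>g = \<nabla>f(y)\<close>, and average over the
  sampled set only. The new \<open>x\<close> is \<open>y + h\<^bsub>[S]\<^esub>\<close> with the fixed displacement \<open>h\<^sup>i = - v\<^sub>i\<^sup>-\<^sup>1 B\<^sub>i\<^sup>-\<^sup>1 g\<^sup>i\<close>, so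
  the overapproximation bounds the expected value of \<open>f\<close> by \<open>f(y) - G/2\<close>, where
  \<open>G = \<Sum>\<^sub>i (p\<^sub>i / v\<^sub>i) \<langle>g\<^sup>i, B\<^sub>i\<^sup>-\<^sup>1 g\<^sup>i\<rangle>\<close> (\<open>expected_value_step\<close>). Expanding the square, the expected
  squared distance of \<open>z\<close> from \<open>x\<^sub>*\<close> changes by exactly \<open>G / \<theta>\<^sup>2 - (2 / \<theta>) \<langle>g, z - x\<^sub>*\<rangle>\<close>
  (\<open>expected_distance_step\<close>). In the Lyapunov function the two terms \<open>G\<close> cancel, and convexity bounds the
  rest by \<open>(1 - \<theta>) (f(x) - f(x\<^sub>*)) + \<theta>\<^sup>2/2 \<parallel>z - x\<^sub>*\<parallel>\<^sup>2\<close> (\<open>expected_energy_step\<close>).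

  The sets drawn are independent and take finitely many values, so the expectation over the whole run
  can be computed by averaging the newest set first (\<open>expectation_next_sample\<close>). Since
  \<open>\<theta>\<^sub>k\<^sub>+\<^sub>1\<^sup>2 = (1 - \<theta>\<^sub>k\<^sub>+\<^sub>1) \<theta>\<^sub>k\<^sup>2\<close>, the one-step bounds chain to
  \<open>E[f(x\<^sub>k\<^sub>+\<^sub>1)] - f(x\<^sub>*) \<le> \<theta>\<^sub>k\<^sup>2/2 \<parallel>x\<^sub>0 - x\<^sub>*\<parallel>\<^sup>2\<close> (\<open>expected_energy_le\<close>), and \<open>\<theta>\<^sub>k \<le> 2 / (k + 2)\<close> gives the rate.
\<close>

section \<open>Block projections\<close>

lemma block_nth: "block b i x $ j = (if b j = i then x $ j else 0)"
  by (simp add: block_def)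

lemma block_add: "block b i (x + y) = block b i x + block b i y"
  and block_diff: "block b i (x - y) = block b i x - block b i y"
  and block_scaleR: "block b i (c *\<^sub>R x) = c *\<^sub>R block b i x"
  and block_0: "block b i 0 = 0"
  by (auto simp: vec_eq_iff block_nth)

lemma block_sum: "block b i (\<Sum>k\<in>A. x k) = (\<Sum>k\<in>A. block b i (x k))"
  by (induction A rule: infinite_finite_induct) (auto simp: block_add block_0)

lemma block_block: "block b i (block b k x) = (if i = k then block b k x else 0)"
  by (auto simp: vec_eq_iff block_nth)

lemma sum_block:
  fixes b :: "'N::finite \<Rightarrow> 'n::finite"
  shows "(\<Sum>i\<in>UNIV. block b i x) = x"
  by (simp add: vec_eq_iff block_nth)

lemma inner_block_left: "block b i x \<bullet> y = block b i x \<bullet> block b i y"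
  by (auto simp: inner_vec_def block_nth intro!: sum.cong)

lemma block_sum_blocks:
  fixes b :: "'N::finite \<Rightarrow> 'n::finite"
  assumes "\<And>k. block b k (u k) = u k"
  shows "block b i (\<Sum>k\<in>UNIV. u k) = u i"
proof -
  have "block b i (\<Sum>k\<in>UNIV. u k) = (\<Sum>k\<in>UNIV. block b i (block b k (u k)))"
    by (simp add: block_sum assms)
  also have "\<dots> = (\<Sum>k\<in>UNIV. if k = i then u k else 0)"
  proof (intro sum.cong refl)
    fix k
    show "block b i (block b k (u k)) = (if k = i then u k else 0)"
      unfolding block_block by (simp add: assms)
  qed
  also have "\<dots> = u i"
    by simp
  finally show ?thesis .
qed

lemma inner_eq_sum_blocks:
  fixes b :: "'N::finite \<Rightarrow> 'n::finite"
  shows "x \<bullet> y = (\<Sum>i\<in>UNIV. block b i x \<bullet> block b i y)"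
proof -
  have "x \<bullet> y = (\<Sum>i\<in>UNIV. block b i x) \<bullet> y"
    by (simp add: sum_block)
  then show ?thesis
    by (simp add: inner_sum_left inner_block_left[symmetric])
qed

section \<open>Block matrices and their inverses\<close>

lemma block_id_mult: "block_id b i *v x = block b i x"
proof -
  have "block_id b i $ j $ k * x $ k = (if k = j then block b i x $ j else 0)" for j k
    by (simp add: block_nth block_id_def)
  then show ?thesis
    by (simp add: vec_eq_iff matrix_vector_mult_def)
qed

lemma block_matrix_mult:
  assumes "block_matrix b i A"
  shows "block b i (A *v x) = A *v x" "A *v block b i x = A *v x"
proof -
  show "block b i (A *v x) = A *v x"
    using assms by (auto simp: vec_eq_iff block_nth matrix_vector_mult_def block_matrix_def)
  have "A $ j $ k * block b i x $ k = A $ j $ k * x $ k" for j k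
    using assms by (cases "b k = i") (auto simp: block_nth block_matrix_def)
  then show "A *v block b i x = A *v x"
    by (simp only: vec_eq_iff matrix_vector_mult_def vec_lambda_beta simp_thms)
qed

text \<open>Reading off the columns of \<open>A\<close> shows that these two identities characterise zero extensions of
  \<open>N\<^sub>i \<times> N\<^sub>i\<close> matrices; they are how such matrices are recognised from their action on vectors.\<close>

lemma block_matrixI:
  fixes A :: "real^'N::finite^'N"
  assumes "\<And>x. block b i (A *v x) = A *v x" "\<And>x. A *v block b i x = A *v x"
  shows "block_matrix b i A"
  unfolding block_matrix_def
proof (intro allI impI)
  fix j k assume jk: "\<not> (b j = i \<and> b k = i)"
  have col: "A $ j $ k = (A *v axis k 1) $ j"
    by (simp add: matrix_vector_mult_basis column_def)
  show "A $ j $ k = 0"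
  proof (cases "b j = i")
    case True
    then have "block b i (axis k 1) = (0 :: real^'N)"
      using jk by (auto simp: vec_eq_iff block_nth axis_def)
    then show ?thesis
      using assms(2)[of "axis k 1"] by (simp add: col)
  next
    case False
    then show ?thesis
      using assms(1)[of "axis k 1"] block_nth[of b i "A *v axis k 1" j] by (simp add: col)
  qed
qed

lemma block_pos_def_inner_commute:
  assumes "block_pos_def b i A"
  shows "(A *v x) \<bullet> y = x \<bullet> (A *v y)"
  using assms by (metis block_pos_def_def dot_lmul_matrix transpose_matrix_vector)

lemma block_pos_def_injective:
  assumes "block_pos_def b i A" "A *v x = 0"
  shows "block b i x = 0"
  using assms by (metis block_matrix_mult(2) block_pos_def_def inner_zero_left less_irrefl)

text \<open>Completing \<open>A\<close> by the identity on the other blocks gives a matrix \<open>C\<close> with trivial kernel. It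
  commutes with the block projection \<open>P\<close>, hence so does \<open>C\<^sup>-\<^sup>1\<close>, and cutting \<open>C\<^sup>-\<^sup>1\<close> down to the block
  gives the inverse within the block.\<close>

lemma block_inverse_exists:
  fixes A :: "real^'N::finite^'N"
  assumes A: "block_pos_def b i A"
  shows "\<exists>A'. block_matrix b i A' \<and> A ** A' = block_id b i \<and> A' ** A = block_id b i"
proof -
  let ?P = "block_id b i :: real^'N^'N"
  have bm: "block_matrix b i A"
    using A by (simp add: block_pos_def_def)
  define C where "C = A + (mat 1 - ?P)"
  have C_mult: "C *v x = A *v x + (x - block b i x)" for x
    by (simp add: C_def matrix_vector_mult_add_rdistrib matrix_vector_mult_diff_rdistrib block_id_mult)
  have "x = 0" if "C *v x = 0" for x
  proof -
    have "block b i (C *v x) = A *v x"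
      by (simp add: C_mult block_add block_diff block_block block_matrix_mult[OF bm])
    then have "A *v x = 0"
      using that by (simp add: block_0)
    then show ?thesis
      using that block_pos_def_injective[OF A] by (simp add: C_mult)
  qed
  then obtain C' where C'C: "C' ** C = mat 1"
    using matrix_left_invertible_ker by blast
  then have CC': "C ** C' = mat 1"
    using matrix_left_right_inverse by blast
  have C'C_mult: "C' *v (C *v x) = x" and CC'_mult: "C *v (C' *v x) = x" for x
    by (simp_all add: matrix_vector_mul_assoc C'C CC')
  have C_block: "C *v block b i x = A *v x" "block b i (C *v x) = A *v x" for x
    by (simp_all add: C_mult block_add block_diff block_block block_matrix_mult[OF bm])
  have C'_block: "C' *v block b i x = block b i (C' *v x)" for x
  proof -
    have "C *v block b i (C' *v x) = block b i x"
      using C_block[of "C' *v x"] by (simp add: CC'_mult)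
    then show ?thesis
      using C'C_mult by metis
  qed
  let ?A' = "?P ** C'"
  have A'_mult: "?A' *v x = block b i (C' *v x)" for x
    by (simp add: block_id_mult flip: matrix_vector_mul_assoc)
  have "block_matrix b i ?A'"
    by (rule block_matrixI) (simp_all add: A'_mult block_block C'_block)
  moreover have "A *v (?A' *v x) = block b i x" for x
    using C_block(2)[of "C' *v x"] by (simp add: A'_mult block_matrix_mult[OF bm] CC'_mult)
  then have "A ** ?A' = ?P"
    by (simp add: matrix_eq block_id_mult flip: matrix_vector_mul_assoc)
  moreover have "?A' *v (A *v x) = block b i x" for x
    using C'C_mult[of "block b i x"] by (simp add: A'_mult C_block block_block)
  then have "?A' ** A = ?P"
    by (simp add: matrix_eq block_id_mult flip: matrix_vector_mul_assoc)
  ultimately show ?thesis by blast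
qed

text \<open>Two inverses within the block agree by the usual argument
  \<open>A\<^sub>1 = P A\<^sub>1 = A\<^sub>2 A A\<^sub>1 = A\<^sub>2 P = A\<^sub>2\<close>, so the definite description in the definition denotes.\<close>

lemma block_inv_inverse:
  fixes A :: "real^'N::finite^'N"
  assumes A: "block_pos_def b i A"
  shows "block_matrix b i (block_inv b i A) \<and> A ** block_inv b i A = block_id b i
    \<and> block_inv b i A ** A = block_id b i"
proof -
  let ?inv = "\<lambda>A'. block_matrix b i A' \<and> A ** A' = block_id b i \<and> A' ** A = block_id b i"
  have "A1 = A2" if A1: "?inv A1" and A2: "?inv A2" for A1 A2 :: "real^'N^'N"
  proof -
    have "A1 *v x = A2 *v x" for x
    proof -
      have bm1: "block_matrix b i A1" and bm2: "block_matrix b i A2"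
        using A1 A2 by auto
      have "A1 *v x = block b i (A1 *v x)"
        by (rule block_matrix_mult(1)[OF bm1, symmetric])
      also have "\<dots> = (A2 ** A) *v (A1 *v x)"
        using A2 by (simp only: block_id_mult)
      also have "\<dots> = A2 *v ((A ** A1) *v x)"
        by (simp only: matrix_vector_mul_assoc matrix_mul_assoc)
      also have "\<dots> = A2 *v block b i x"
        using A1 by (simp only: block_id_mult)
      also have "\<dots> = A2 *v x"
        by (rule block_matrix_mult(2)[OF bm2])
      finally show ?thesis .
    qed
    then show ?thesis
      by (simp add: matrix_eq)
  qed
  then have "\<exists>!A'. ?inv A'"
    using block_inverse_exists[OF A] by (intro ex_ex1I)
  then show ?thesis
    unfolding block_inv_def by (rule theI')
qed

lemmas block_matrix_block_inv = block_inv_inverse[THEN conjunct1]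
  and block_inv_right = block_inv_inverse[THEN conjunct2, THEN conjunct1]

text \<open>These two equations are the only properties of the search direction \<open>B\<^sub>i\<^sup>-\<^sup>1 \<nabla>\<^sub>i f(y)\<close> that enter
  the analysis of the algorithm.\<close>

lemma block_inv_mult:
  assumes "block_pos_def b i A"
  shows "block b i (block_inv b i A *v x) = block_inv b i A *v x"
    and "A *v (block_inv b i A *v x) = block b i x"
proof -
  show "block b i (block_inv b i A *v x) = block_inv b i A *v x"
    by (rule block_matrix_mult(1)[OF block_matrix_block_inv[OF assms]])
  show "A *v (block_inv b i A *v x) = block b i x"
    by (simp only: matrix_vector_mul_assoc block_inv_right[OF assms] block_id_mult)
qed

section \<open>Gradients and convexity\<close>

text \<open>The Riesz representation of the derivative, here obtained from its adjoint, is a gradient; a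
  derivative determines its representing vector, so it is the gradient.\<close>

lemma has_derivative_grad:
  assumes "f differentiable (at x)"
  shows "(f has_derivative (\<lambda>h. h \<bullet> grad f x)) (at x)"
proof -
  obtain f' where f': "(f has_derivative f') (at x)"
    using assms by (auto simp: differentiable_def)
  have "f' = (\<lambda>h. h \<bullet> adjoint f' 1)"
    using adjoint_works[OF has_derivative_linear[OF f'], of _ 1] by auto
  then have ex: "GDERIV f x :> adjoint f' 1"
    using f' by (simp add: gderiv_def)
  have "g = g'" if "GDERIV f x :> g" "GDERIV f x :> g'" for g g'
    using has_derivative_unique[OF that[unfolded gderiv_def]] by (metis vector_eq_ldot)
  then have "\<exists>!g. GDERIV f x :> g"
    using ex by (intro ex_ex1I) blast+
  then have "GDERIV f x :> grad f x"
    unfolding grad_def by (rule theI')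
  then show ?thesis
    by (simp add: gderiv_def)
qed

text \<open>On the line from \<open>x\<close> to \<open>u\<close> this is the tangent inequality for a convex function of one real
  variable.\<close>

lemma convex_above_tangent:
  assumes conv: "convex_on UNIV f" and diff: "f differentiable (at x)"
  shows "f u \<ge> f x + grad f x \<bullet> (u - x)"
proof -
  let ?l = "\<lambda>t::real. x + t *\<^sub>R (u - x)"
  have "((f \<circ> ?l) has_derivative (\<lambda>h. h \<bullet> grad f x) \<circ> (\<lambda>t. t *\<^sub>R (u - x))) (at 0)"
    by (rule diff_chain_at) (auto intro!: derivative_eq_intros has_derivative_grad diff)
  then have "((\<lambda>t. f (?l t)) has_real_derivative grad f x \<bullet> (u - x)) (at 0)"
    by (simp add: has_field_derivative_def o_def inner_commute mult.commute[of _ "_ \<bullet> _"]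
          fun_eq_iff)
  moreover have "convex_on UNIV (\<lambda>t. f (?l t))"
  proof (rule convex_onI)
    fix t r s :: real assume t: "0 < t" "t < 1"
    have "?l ((1 - t) *\<^sub>R r + t *\<^sub>R s) = (1 - t) *\<^sub>R ?l r + t *\<^sub>R ?l s"
      by (simp add: algebra_simps)
    then show "f (?l ((1 - t) *\<^sub>R r + t *\<^sub>R s)) \<le> (1 - t) * f (?l r) + t * f (?l s)"
      using convex_onD[OF conv, of t "?l r" "?l s"] t by simp
  qed auto
  ultimately have "f (?l 1) - f (?l 0) \<ge> (grad f x \<bullet> (u - x)) * (1 - 0)"
    by (intro convex_on_imp_above_tangent[where A=UNIV]) auto
  then show ?thesis by simp
qed

section \<open>The step sizes\<close>

lemma theta_pos: "theta k > 0"
proof (induction k)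
  case (Suc k)
  have "theta k ^ 2 = sqrt (theta k ^ 4)"
    by (rule real_sqrt_unique[symmetric]) (simp_all flip: power_mult)
  also have "\<dots> < sqrt (theta k ^ 4 + 4 * theta k ^ 2)"
    using Suc by (intro real_sqrt_less_mono) simp
  finally show ?case by simp
qed simp

text \<open>The recursion selects \<open>\<theta>\<^sub>k\<^sub>+\<^sub>1\<close> as the positive root of \<open>t\<^sup>2 + \<theta>\<^sub>k\<^sup>2 t - \<theta>\<^sub>k\<^sup>2 = 0\<close>. In this form it
  makes the energies of consecutive steps telescope.\<close>

lemma theta_Suc_sq: "theta (Suc k) ^ 2 = (1 - theta (Suc k)) * theta k ^ 2"
proof -
  let ?r = "sqrt (theta k ^ 4 + 4 * theta k ^ 2)"
  have "?r ^ 2 = (theta k ^ 2) ^ 2 + 4 * theta k ^ 2"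
    by (simp add: power_mult[symmetric])
  then show ?thesis
    by (simp add: power2_eq_square[of "_ * _"] power2_eq_square[of "_ - _"] field_simps)
qed

lemma theta_le_1: "theta k \<le> 1"
proof (cases k)
  case (Suc m)
  have "0 \<le> (1 - theta k) * theta m ^ 2"
    using theta_Suc_sq[of m] Suc by (metis zero_le_power2)
  then show ?thesis
    using theta_pos[of m] by (simp add: zero_le_mult_iff)
qed simp

text \<open>The function \<open>t \<mapsto> t\<^sup>2 / (1 - t)\<close> is increasing on \<open>[0, 1)\<close>, so if \<open>\<theta>\<^sub>k\<^sub>+\<^sub>1\<close> exceeded \<open>2 / (k + 3)\<close>, then
  \<open>\<theta>\<^sub>k\<^sup>2 = \<theta>\<^sub>k\<^sub>+\<^sub>1\<^sup>2 / (1 - \<theta>\<^sub>k\<^sub>+\<^sub>1)\<close> would exceed \<open>4 / ((k + 1) (k + 3)) \<ge> 4 / (k + 2)\<^sup>2\<close>.\<close>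

lemma theta_le: "theta k \<le> 2 / (real k + 2)"
proof (induction k)
  case (Suc k)
  let ?t = "theta (Suc k)"
  show ?case
  proof (rule ccontr)
    assume "\<not> ?case"
    then have gt: "?t > 2 / (real k + 3)" by (simp add: add.commute)
    have "?t ^ 2 \<le> (1 - ?t) * (2 / (real k + 2)) ^ 2"
      unfolding theta_Suc_sq using Suc theta_pos[of k] theta_le_1[of "Suc k"]
      by (intro mult_left_mono power_mono) auto
    also have "\<dots> < (1 - 2 / (real k + 3)) * (2 / (real k + 2)) ^ 2"
      using gt by (intro mult_strict_right_mono) auto
    also have "\<dots> \<le> (2 / (real k + 3)) ^ 2"
      by (simp add: divide_simps power2_eq_square) (simp add: algebra_simps)
    also have "\<dots> < ?t ^ 2"
      using gt by (intro power_strict_mono) auto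
    finally show False .
  qed
qed simp


text \<open>From here on the step sizes enter only through their positivity, the bounds and the quadratic
  relation; unfolding the square root would only obscure the algebra.\<close>

declare theta.simps(2) [simp del]

section \<open>One step of the algorithm\<close>

lemma expectation_sum_sampled:
  fixes D :: "'n::finite set pmf"
  shows "measure_pmf.expectation D (\<lambda>S. \<Sum>i\<in>UNIV. if i \<in> S then a i else 0)
    = (\<Sum>i\<in>UNIV. sampling_prob D $ i * a i)"
proof -
  have "measure_pmf.expectation D (\<lambda>S. if i \<in> S then a i else 0) = sampling_prob D $ i * a i" for i
  proof -
    have "(\<lambda>S. if i \<in> S then a i else 0) = (\<lambda>S. indicator {S. i \<in> S} S * a i)"
      by (auto simp: indicator_def)
    then show ?thesis
      by (simp add: sampling_prob_def)
  qed
  then show ?thesis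
    by (subst Bochner_Integration.integral_sum) (auto intro: integrable_measure_pmf_finite)
qed

text \<open>The update of the sequence \<open>z\<^sub>k\<close>, with the step lengths and directions left open: the expansion of
  the squared norm is independent of how they are chosen.\<close>

definition block_step :: "('N::finite \<Rightarrow> 'n::finite) \<Rightarrow> ('n \<Rightarrow> real) \<Rightarrow> ('n \<Rightarrow> real^'N) \<Rightarrow> real^'N \<Rightarrow> 'n set \<Rightarrow> real^'N"
where
  "block_step b c d z S = (\<Sum>i\<in>UNIV. if i \<in> S then block b i z - c i *\<^sub>R d i else block b i z)"

lemma block_block_step:
  assumes "\<And>i. block b i (d i) = d i"
  shows "block b i (block_step b c d z S) = (if i \<in> S then block b i z - c i *\<^sub>R d i else block b i z)"
  unfolding block_step_def
  by (rule block_sum_blocks) (simp add: block_diff block_scaleR block_block assms)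

lemma quadratic_step:
  assumes A: "block_pos_def b i A" and d: "A *v d = g"
  shows "(A *v (e - c *\<^sub>R d)) \<bullet> (e - c *\<^sub>R d) = (A *v e) \<bullet> e - 2 * c * (g \<bullet> e) + c\<^sup>2 * (g \<bullet> d)"
proof -
  have "(A *v e) \<bullet> d = g \<bullet> e"
    using block_pos_def_inner_commute[OF A, of e d] d by (simp add: inner_commute)
  then show ?thesis
    by (simp add: matrix_vector_mult_diff_distrib matrix_vector_mult_scaleR inner_diff_left inner_diff_right
        d power2_eq_square algebra_simps)
qed

text \<open>Only the blocks in \<open>S\<close> move, and each of them changes the squared distance by the linear and the
  quadratic term of its own expansion. So the dependence on \<open>S\<close> is a sum over the sampled blocks,
  whose expectation involves the sampling only through its marginals \<open>p\<^sub>i\<close>.\<close>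

lemma wnorm_sq_block_step:
  fixes b :: "'N::finite \<Rightarrow> 'n::finite"
  assumes B: "\<And>i. block_pos_def b i (B i)"
    and d: "\<And>i. block b i (d i) = d i" "\<And>i. B i *v d i = block b i g"
  shows "wnorm_sq b B w (block_step b c d z S - u) = wnorm_sq b B w (z - u)
    + (\<Sum>i\<in>UNIV. if i \<in> S then w $ i * ((c i)\<^sup>2 * (block b i g \<bullet> d i)
          - 2 * c i * (block b i g \<bullet> block b i (z - u))) else 0)"
proof -
  let ?Q = "\<lambda>i x. (B i *v block b i x) \<bullet> block b i x"
  have "w $ i * ?Q i (block_step b c d z S - u) = w $ i * ?Q i (z - u)
      + (if i \<in> S then w $ i * ((c i)\<^sup>2 * (block b i g \<bullet> d i)
          - 2 * c i * (block b i g \<bullet> block b i (z - u))) else 0)" for i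
  proof (cases "i \<in> S")
    case True
    then have "block b i (block_step b c d z S - u) = block b i (z - u) - c i *\<^sub>R d i"
      by (simp add: block_block_step[OF d(1)] block_diff)
    then show ?thesis
      by (simp only: quadratic_step[OF B d(2)] True if_True) (simp add: algebra_simps)
  next
    case False
    then have "block b i (block_step b c d z S - u) = block b i (z - u)"
      by (simp add: block_block_step[OF d(1)] block_diff)
    then show ?thesis
      using False by simp
  qed
  then show ?thesis
    unfolding wnorm_sq_def by (simp add: sum.distrib)
qed

text \<open>The weights \<open>v\<^sub>i / p\<^sub>i\<^sup>2\<close> are what makes the linear term unbiased: with step length \<open>p\<^sub>i / (v\<^sub>i t)\<close> and
  selection probability \<open>p\<^sub>i\<close>, the coefficient of \<open>\<langle>g\<^sup>i, z\<^sup>i - u\<^sup>i\<rangle>\<close> is \<open>- 2 / t\<close> in every block, and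
  these sum to the full inner product.\<close>

lemma expected_distance_step:
  fixes b :: "'N::finite \<Rightarrow> 'n::finite" and D :: "'n set pmf"
  defines "p \<equiv> sampling_prob D"
  assumes B: "\<And>i. block_pos_def b i (B i)"
    and proper: "proper_sampling D" and v: "\<And>i. v $ i > 0" and t: "t > 0"
    and d: "\<And>i. block b i (d i) = d i" "\<And>i. B i *v d i = block b i g"
  shows "measure_pmf.expectation D
      (\<lambda>S. wnorm_sq b B (v * vec_powi p (-2)) (block_step b (\<lambda>i. p $ i / (v $ i * t)) d z S - u))
    = wnorm_sq b B (v * vec_powi p (-2)) (z - u)
      + (\<Sum>i\<in>UNIV. p $ i / v $ i * (block b i g \<bullet> d i)) / t\<^sup>2 - 2 / t * (g \<bullet> (z - u))"
proof -
  let ?w = "v * vec_powi p (-2)" and ?c = "\<lambda>i. p $ i / (v $ i * t)"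
  let ?G = "\<lambda>i. block b i g \<bullet> d i" and ?E = "\<lambda>i. block b i g \<bullet> block b i (z - u)"
  have p: "p $ i > 0" for i
    using proper by (simp add: proper_sampling_def p_def)
  have summand: "p $ i * (?w $ i * ((?c i)\<^sup>2 * ?G i - 2 * ?c i * ?E i))
      = p $ i / v $ i * ?G i / t\<^sup>2 - 2 / t * ?E i" for i
    using p[of i] v[of i] t
    by (simp add: vec_powi_def power_int_minus field_simps power2_eq_square)
  have "measure_pmf.expectation D (\<lambda>S. wnorm_sq b B ?w (block_step b ?c d z S - u))
      = wnorm_sq b B ?w (z - u) + (\<Sum>i\<in>UNIV. p $ i * (?w $ i * ((?c i)\<^sup>2 * ?G i - 2 * ?c i * ?E i)))"
    unfolding wnorm_sq_block_step[OF B d] p_def expectation_sum_sampled[symmetric]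
    by (subst Bochner_Integration.integral_add) (auto intro: integrable_measure_pmf_finite)
  also have "\<dots> = wnorm_sq b B ?w (z - u)
      + (\<Sum>i\<in>UNIV. p $ i / v $ i * ?G i) / t\<^sup>2 - 2 / t * (\<Sum>i\<in>UNIV. ?E i)"
    by (simp only: summand sum_subtractf sum_divide_distrib sum_distrib_left add_diff_eq)
  finally show ?thesis
    by (simp only: inner_eq_sum_blocks[of g _ b])
qed

text \<open>Seen from \<open>y\<^sub>k\<close>, the next iterate is a random restriction of one fixed displacement
  \<open>h = - \<Sum>\<^sub>i (1 / v\<^sub>i) d\<^sub>i\<close>: the factors \<open>\<theta>\<^sub>k\<close> and \<open>p\<^sub>i\<close> in the step length cancel. This is the shape to
  which the expected separable overapproximation applies.\<close>

lemma block_step_extrapolation: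
  fixes b :: "'N::finite \<Rightarrow> 'n::finite"
  assumes p: "\<And>i. p $ i > 0" and v: "\<And>i. v $ i > 0" and t: "t > 0"
    and d: "\<And>i. block b i (d i) = d i"
  shows "t *\<^sub>R block_scale b (vec_powi p (-1)) (block_step b (\<lambda>i. p $ i / (v $ i * t)) d z S - z)
    = block_restrict b S (\<Sum>i\<in>UNIV. - (1 / v $ i) *\<^sub>R d i)"
proof -
  have h: "block b i (\<Sum>i\<in>UNIV. - (1 / v $ i) *\<^sub>R d i) = - (1 / v $ i) *\<^sub>R d i" for i
    by (rule block_sum_blocks) (simp add: block_scaleR d del: scaleR_minus_left)
  have "t *\<^sub>R (vec_powi p (-1) $ i *\<^sub>R block b i (block_step b (\<lambda>i. p $ i / (v $ i * t)) d z S - z))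
      = (if i \<in> S then - (1 / v $ i) *\<^sub>R d i else 0)" for i
    using p[of i] v[of i] t
    by (simp add: block_diff block_block_step d vec_powi_def power_int_minus)
  then show ?thesis
    unfolding block_scale_def block_restrict_def scaleR_sum_right h by (simp add: sum.If_cases)
qed

text \<open>The displacement minimises the overapproximation block by block, so the quadratic term gives back
  exactly half of what the linear term gains.\<close>

lemma expected_value_step:
  fixes b :: "'N::finite \<Rightarrow> 'n::finite" and D :: "'n set pmf"
  assumes eso: "ESO b B f D v" and v: "\<And>i. v $ i > 0"
    and d: "\<And>i. block b i (d i) = d i" "\<And>i. B i *v d i = block b i (grad f y)"
  shows "measure_pmf.expectation D
      (\<lambda>S. f (y + block_restrict b S (\<Sum>i\<in>UNIV. - (1 / v $ i) *\<^sub>R d i)))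
    \<le> f y - 1/2 * (\<Sum>i\<in>UNIV. sampling_prob D $ i / v $ i * (block b i (grad f y) \<bullet> d i))"
proof -
  let ?p = "sampling_prob D" and ?h = "\<Sum>i\<in>UNIV. - (1 / v $ i) *\<^sub>R d i"
  let ?G = "\<lambda>i. ?p $ i / v $ i * (block b i (grad f y) \<bullet> d i)"
  have h: "block b i ?h = - (1 / v $ i) *\<^sub>R d i" for i
    by (rule block_sum_blocks) (simp add: block_scaleR d del: scaleR_minus_left)
  have lin: "?p $ i * (block b i (grad f y) \<bullet> block b i ?h) = - ?G i" for i
    unfolding h by simp
  have quad: "(v * ?p) $ i * ((B i *v block b i ?h) \<bullet> block b i ?h) = ?G i" for i
    using v[of i] unfolding h matrix_vector_mult_scaleR d(2) by simp
  have "winner b ?p (grad f y) ?h = - sum ?G UNIV" "wnorm_sq b B (v * ?p) ?h = sum ?G UNIV"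
    unfolding winner_def wnorm_sq_def lin quad by (simp_all add: sum_negf)
  then show ?thesis
    using eso[unfolded ESO_def, rule_format, of y ?h] by simp
qed

text \<open>One iteration as a function of the pair \<open>(x\<^sub>k, z\<^sub>k)\<close> and the sampled set, so that the sampled set can
  be averaged with the pair held fixed.\<close>

definition apcd_step ::
  "('N::finite \<Rightarrow> 'n::finite) \<Rightarrow> ('n \<Rightarrow> real^'N^'N) \<Rightarrow> (real^'N \<Rightarrow> real) \<Rightarrow> real^'n \<Rightarrow> real^'n
    \<Rightarrow> real \<Rightarrow> (real^'N) \<times> (real^'N) \<Rightarrow> 'n set \<Rightarrow> (real^'N) \<times> (real^'N)"
where
  "apcd_step b B f p v t s S =
     (let y = (1 - t) *\<^sub>R fst s + t *\<^sub>R snd s;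
          z' = block_step b (\<lambda>i. p $ i / (v $ i * t))
                 (\<lambda>i. block_inv b i (B i) *v block b i (grad f y)) (snd s) S
      in (y + t *\<^sub>R block_scale b (vec_powi p (-1)) (z' - snd s), z'))"

lemma apcd_Suc_eq_step:
  "apcd b B f p v x0 T (Suc k) = apcd_step b B f p v (theta k) (apcd b B f p v x0 T k) (T k)"
  by (simp add: apcd_step_def block_step_def Let_def case_prod_beta)

lemma apcd_cong:
  "(\<And>j. j < k \<Longrightarrow> T j = T' j) \<Longrightarrow> apcd b B f p v x0 T k = apcd b B f p v x0 T' k"
proof (induction k)
  case (Suc k)
  then show ?case
    unfolding apcd_Suc_eq_step by simp
qed simp

declare apcd.simps(2) [simp del]

text \<open>The Lyapunov function relative to a reference point \<open>u\<close>. The parameter \<open>t\<close> belongs to the step that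
  produced the state: \<open>(x\<^sub>k\<^sub>+\<^sub>1, z\<^sub>k\<^sub>+\<^sub>1)\<close> is measured with \<open>t = \<theta>\<^sub>k\<close>.\<close>

definition energy ::
  "('N::finite \<Rightarrow> 'n::finite) \<Rightarrow> ('n \<Rightarrow> real^'N^'N) \<Rightarrow> (real^'N \<Rightarrow> real) \<Rightarrow> real^'n \<Rightarrow> real^'N
    \<Rightarrow> real \<Rightarrow> (real^'N) \<times> (real^'N) \<Rightarrow> real"
where
  "energy b B f w u t s = f (fst s) - f u + t\<^sup>2 / 2 * wnorm_sq b B w (snd s - u)"

text \<open>The gain \<open>\<Sum>\<^sub>i (p\<^sub>i / v\<^sub>i) \<langle>g\<^sup>i, d\<^sub>i\<rangle>\<close> appears with the factor \<open>- 1/2\<close> in the function value and, after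
  scaling by \<open>t\<^sup>2 / 2\<close>, with the factor \<open>1/2\<close> in the distance, and cancels. What remains is
  \<open>f y - t \<langle>g, z - u\<rangle>\<close>; as \<open>y\<close> is the combination of \<open>x\<close> and \<open>z\<close> with weight \<open>t\<close>, this is the same
  combination of the tangent to \<open>f\<close> at \<open>y\<close> evaluated at \<open>x\<close> and at \<open>u\<close>, and convexity applies.\<close>

lemma expected_energy_step:
  fixes b :: "'N::finite \<Rightarrow> 'n::finite" and D :: "'n set pmf" and v :: "real^'n"
  defines "p \<equiv> sampling_prob D"
  defines "w \<equiv> v * vec_powi p (-2)"
  assumes B: "\<And>i. block_pos_def b i (B i)"
    and conv: "convex_on UNIV f" and diff: "f differentiable_on UNIV"
    and proper: "proper_sampling D" and v: "\<And>i. v $ i > 0" and eso: "ESO b B f D v"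
    and t: "0 < t" "t \<le> 1"
  shows "measure_pmf.expectation D (\<lambda>S. energy b B f w u t (apcd_step b B f p v t (x, z) S))
    \<le> (1 - t) * (f x - f u) + t\<^sup>2 / 2 * wnorm_sq b B w (z - u)"
proof -
  define y where "y = (1 - t) *\<^sub>R x + t *\<^sub>R z"
  define g where "g = grad f y"
  define d where "d = (\<lambda>i. block_inv b i (B i) *v block b i g)"
  define h where "h = (\<Sum>i\<in>UNIV. - (1 / v $ i) *\<^sub>R d i)"
  let ?z' = "block_step b (\<lambda>i. p $ i / (v $ i * t)) d z"
  let ?G = "\<Sum>i\<in>UNIV. p $ i / v $ i * (block b i g \<bullet> d i)"
  have d: "block b i (d i) = d i" "B i *v d i = block b i g" for i
    using block_inv_mult[OF B, of i "block b i g"] by (simp_all add: d_def block_block)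
  have p: "p $ i > 0" for i
    using proper by (simp add: proper_sampling_def p_def)
  have diff_y: "f differentiable (at y)"
    using diff by (simp add: differentiable_on_def)
  have step: "apcd_step b B f p v t (x, z) S = (y + block_restrict b S h, ?z' S)" for S
    using block_step_extrapolation[where z=z and S=S, OF p v t(1) d(1)]
    by (simp add: apcd_step_def Let_def y_def g_def d_def h_def)
  have "measure_pmf.expectation D (\<lambda>S. energy b B f w u t (apcd_step b B f p v t (x, z) S))
      = measure_pmf.expectation D (\<lambda>S. f (y + block_restrict b S h)) - f u
        + t\<^sup>2 / 2 * measure_pmf.expectation D (\<lambda>S. wnorm_sq b B w (?z' S - u))"
    by (simp add: step energy_def Bochner_Integration.integral_add Bochner_Integration.integral_diff
        integrable_measure_pmf_finite)
  also have "\<dots> \<le> f y - 1/2 * ?G - f u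
      + t\<^sup>2 / 2 * (wnorm_sq b B w (z - u) + ?G / t\<^sup>2 - 2 / t * (g \<bullet> (z - u)))"
    using expected_value_step[OF eso v d(1) d(2)[unfolded g_def]]
      expected_distance_step[OF B proper v t(1) d]
    by (simp add: p_def w_def g_def h_def)
  also have "\<dots> = f y - f u + t\<^sup>2 / 2 * wnorm_sq b B w (z - u) - g \<bullet> (t *\<^sub>R (z - u))"
    unfolding inner_scaleR_right using t(1) by (simp add: field_simps power2_eq_square)
  \<comment> \<open>The definition of \<open>y\<close> trades \<open>z\<close> for points at which \<open>f\<close> is evaluated in the bound.\<close>
  also have "t *\<^sub>R (z - u) = - ((1 - t) *\<^sub>R (x - y) + t *\<^sub>R (u - y))"
    by (simp add: y_def algebra_simps)
  also have "f y - f u + t\<^sup>2 / 2 * wnorm_sq b B w (z - u) - g \<bullet> \<dots>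
      = (1 - t) * (f y + g \<bullet> (x - y)) + t * (f y + g \<bullet> (u - y)) - f u + t\<^sup>2 / 2 * wnorm_sq b B w (z - u)"
    by (simp only: inner_add_right inner_minus_right inner_scaleR_right) (simp add: algebra_simps)
  also have "\<dots> \<le> (1 - t) * f x + t * f u - f u + t\<^sup>2 / 2 * wnorm_sq b B w (z - u)"
    using t convex_above_tangent[OF conv diff_y]
    unfolding g_def by (intro add_mono diff_mono mult_left_mono) auto
  finally show ?thesis
    by (simp add: algebra_simps)
qed

section \<open>Averaging over the past\<close>

context prob_space
begin

text \<open>A function of finitely many values in a finite type takes finitely many values, and the product
  \<open>\<sigma>\<close>-algebra is discrete. So measurability and integrability hold whatever the function is, and no
  regularity of the iterates has to be tracked.\<close>

lemma measurable_finite_history: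
  fixes S :: "nat \<Rightarrow> 'a \<Rightarrow> 's::finite" and F :: "(nat \<Rightarrow> 's) \<Rightarrow> real"
  assumes rv: "\<And>k. random_variable (count_space UNIV) (S k)"
    and F: "\<And>T T'. (\<And>j. j < k \<Longrightarrow> T j = T' j) \<Longrightarrow> F T = F T'"
  shows "F \<in> borel_measurable (PiM {..<k} (\<lambda>_. count_space UNIV))"
    and "integrable M (\<lambda>\<omega>. F (\<lambda>j. S j \<omega>))"
proof -
  have PiM: "PiM {..<k} (\<lambda>_. count_space (UNIV :: 's set)) = count_space (PiE {..<k} (\<lambda>_. UNIV))"
    by (rule count_space_PiM_finite) auto
  then show meas: "F \<in> borel_measurable (PiM {..<k} (\<lambda>_. count_space UNIV))"
    by simp
  let ?R = "\<lambda>\<omega>. restrict (\<lambda>j. S j \<omega>) {..<k}"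
  have R: "F (\<lambda>j. S j \<omega>) = F (?R \<omega>)" for \<omega>
    by (rule F) simp
  have fin: "finite (F ` PiE {..<k} (\<lambda>_. UNIV))"
    by (intro finite_imageI finite_PiE) auto
  have "?R \<in> measurable M (PiM {..<k} (\<lambda>_. count_space UNIV))"
    by (rule measurable_restrict) (rule rv)
  then have "(\<lambda>\<omega>. F (?R \<omega>)) \<in> borel_measurable M"
    using meas by (rule measurable_compose)
  moreover have "\<bar>F (?R \<omega>)\<bar> \<le> Max (abs ` F ` PiE {..<k} (\<lambda>_. UNIV))" for \<omega>
    using fin by (intro Max_ge) auto
  ultimately show "integrable M (\<lambda>\<omega>. F (\<lambda>j. S j \<omega>))"
    unfolding R by (intro integrable_const_bound) auto
qed

text \<open>Conditionally on the first \<open>k\<close> samples, the next one still has law \<open>D\<close>. The finitely many values of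
  the sample reduce this to the product rule for the independent variables \<open>\<Phi> (\<dots>) s\<close> and
  \<open>1\<^bsub>S\<^sub>k = s\<^esub>\<close>.\<close>

lemma expectation_next_sample:
  fixes S :: "nat \<Rightarrow> 'a \<Rightarrow> 's::finite" and \<Phi> :: "(nat \<Rightarrow> 's) \<Rightarrow> 's \<Rightarrow> real"
  assumes indep: "indep_vars (\<lambda>_. count_space UNIV) S UNIV"
    and law: "distr M (count_space UNIV) (S k) = measure_pmf D"
    and \<Phi>: "\<And>T T' s. (\<And>j. j < k \<Longrightarrow> T j = T' j) \<Longrightarrow> \<Phi> T s = \<Phi> T' s"
  shows "expectation (\<lambda>\<omega>. \<Phi> (\<lambda>j. S j \<omega>) (S k \<omega>))
    = expectation (\<lambda>\<omega>. measure_pmf.expectation D (\<Phi> (\<lambda>j. S j \<omega>)))"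
proof -
  have rv: "random_variable (count_space UNIV) (S j)" for j
    using indep by (simp add: indep_vars_def)
  let ?X = "\<lambda>s \<omega>. \<Phi> (\<lambda>j. S j \<omega>) s" and ?Y = "\<lambda>s \<omega>. indicator {s} (S k \<omega>) :: real"
  note history = measurable_finite_history[OF rv, where F="\<lambda>T. \<Phi> T _", OF \<Phi>]
  have ind: "indep_var borel (?X s) borel (?Y s)" for s
  proof -
    have "indep_var borel ((\<lambda>T. \<Phi> T s) \<circ> (\<lambda>\<omega>. restrict (\<lambda>j. S j \<omega>) {..<k}))
        borel ((\<lambda>T. indicator {s} (T k)) \<circ> (\<lambda>\<omega>. restrict (\<lambda>j. S j \<omega>) {k}))"
      by (rule indep_var_compose[OF indep_var_restrict[OF indep]]) (auto intro: history)
    moreover have "(\<lambda>T. \<Phi> T s) \<circ> (\<lambda>\<omega>. restrict (\<lambda>j. S j \<omega>) {..<k}) = ?X s"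
      by (auto simp: fun_eq_iff intro: \<Phi>)
    ultimately show ?thesis
      by (simp add: o_def)
  qed
  have Y: "expectation (?Y s) = pmf D s" for s
  proof -
    have "expectation (?Y s) = integral\<^sup>L (distr M (count_space UNIV) (S k)) (indicator {s})"
      using rv by (subst integral_distr) auto
    then show ?thesis
      by (simp add: law pmf.rep_eq)
  qed
  have int_X: "integrable M (?X s)" for s
    by (rule history(2))
  have int_Y: "integrable M (?Y s)" for s
  proof -
    have "?Y s \<in> borel_measurable M"
      by (rule measurable_compose[OF rv]) simp
    then show ?thesis
      by (intro integrable_const_bound[where B=1]) simp_all
  qed
  have XY: "integrable M (\<lambda>\<omega>. ?X s \<omega> * ?Y s \<omega>)"
    "expectation (\<lambda>\<omega>. ?X s \<omega> * ?Y s \<omega>) = expectation (?X s) * pmf D s" for s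
    using indep_var_integrable[OF ind int_X int_Y] indep_var_lebesgue_integral[OF ind int_X int_Y]
    by (simp_all only: Y)
  have "expectation (\<lambda>\<omega>. \<Phi> (\<lambda>j. S j \<omega>) (S k \<omega>)) = expectation (\<lambda>\<omega>. \<Sum>s\<in>UNIV. ?X s \<omega> * ?Y s \<omega>)"
    by (simp add: indicator_def)
  also have "\<dots> = (\<Sum>s\<in>UNIV. expectation (?X s) * pmf D s)"
    by (simp only: Bochner_Integration.integral_sum XY)
  also have "\<dots> = expectation (\<lambda>\<omega>. \<Sum>s\<in>UNIV. ?X s \<omega> * pmf D s)"
    using int_X by (simp add: Bochner_Integration.integral_sum)
  finally show ?thesis
    by (simp add: integral_measure_pmf_real[where A=UNIV])
qed

end

lemma integrable_apcd:
  fixes S :: "nat \<Rightarrow> 'w \<Rightarrow> 'n::finite set" and F :: "(real^'N::finite) \<times> (real^'N) \<Rightarrow> real"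
  assumes M: "prob_space M"
    and indep: "prob_space.indep_vars M (\<lambda>_. count_space UNIV) S UNIV"
  shows "integrable M (\<lambda>\<omega>. F (apcd b B f p v x0 (\<lambda>j. S j \<omega>) k))"
proof -
  interpret prob_space M by (rule M)
  have rv: "random_variable (count_space UNIV) (S j)" for j
    using indep by (simp add: indep_vars_def)
  show ?thesis
    by (rule measurable_finite_history(2)[OF rv, where F="\<lambda>T. F (apcd b B f p v x0 T k)" and k=k])
      (metis apcd_cong)
qed

section \<open>The convergence rate\<close>

lemma wnorm_sq_nonneg:
  assumes B: "\<And>i. block_pos_def b i (B i)" and w: "\<And>i. w $ i \<ge> 0"
  shows "wnorm_sq b B w x \<ge> 0"
  unfolding wnorm_sq_def
proof (intro sum_nonneg mult_nonneg_nonneg w)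
  fix i
  show "0 \<le> (B i *v block b i x) \<bullet> block b i x"
    using B[of i] unfolding block_pos_def_def
    by (cases "block b i x = 0") (auto intro: less_imp_le)
qed

text \<open>As \<open>\<theta>\<^sub>0 = 1\<close>, the first step starts from the distance term alone. Afterwards the identity
  \<open>\<theta>\<^sub>k\<^sub>+\<^sub>1\<^sup>2 = (1 - \<theta>\<^sub>k\<^sub>+\<^sub>1) \<theta>\<^sub>k\<^sup>2\<close> makes the right-hand side of the one-step bound
  equal to \<open>1 - \<theta>\<^sub>k\<^sub>+\<^sub>1\<close> times the previous energy, so that the bound on the expected energy shrinks in
  proportion to \<open>\<theta>\<^sub>k\<^sup>2\<close>.\<close>

lemma expected_energy_le:
  fixes b :: "'N::finite \<Rightarrow> 'n::finite" and D :: "'n set pmf" and v :: "real^'n" and S :: "nat \<Rightarrow> 'w \<Rightarrow> 'n set"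
  defines "p \<equiv> sampling_prob D"
  defines "w \<equiv> v * vec_powi p (-2)"
  assumes B: "\<And>i. block_pos_def b i (B i)"
    and conv: "convex_on UNIV f" and diff: "f differentiable_on UNIV"
    and proper: "proper_sampling D" and v: "\<And>i. v $ i > 0" and eso: "ESO b B f D v"
    and M: "prob_space M"
    and indep: "prob_space.indep_vars M (\<lambda>_. count_space UNIV) S UNIV"
    and law: "\<And>k. distr M (count_space UNIV) (S k) = measure_pmf D"
  shows "(\<integral>\<omega>. energy b B f w u (theta k) (apcd b B f p v x0 (\<lambda>j. S j \<omega>) (Suc k)) \<partial>M)
    \<le> theta k ^ 2 / 2 * wnorm_sq b B w (x0 - u)"
proof -
  interpret prob_space M by (rule M)
  let ?A = "\<lambda>k \<omega>. apcd b B f p v x0 (\<lambda>j. S j \<omega>) k"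
  let ?R = "\<lambda>k s. (1 - theta k) * (f (fst s) - f u) + theta k ^ 2 / 2 * wnorm_sq b B w (snd s - u)"
  note int = integrable_apcd[OF M indep]
  have step: "expectation (\<lambda>\<omega>. energy b B f w u (theta k) (?A (Suc k) \<omega>)) \<le> expectation (\<lambda>\<omega>. ?R k (?A k \<omega>))" for k
  proof -
    let ?\<Phi> = "\<lambda>T s. energy b B f w u (theta k) (apcd_step b B f p v (theta k) (apcd b B f p v x0 T k) s)"
    have loc: "?\<Phi> T s = ?\<Phi> T' s" if "\<And>j. j < k \<Longrightarrow> T j = T' j" for T T' s
    proof -
      have "apcd b B f p v x0 T k = apcd b B f p v x0 T' k"
        by (rule apcd_cong) (rule that)
      then show ?thesis by simp
    qed
    have "expectation (\<lambda>\<omega>. energy b B f w u (theta k) (?A (Suc k) \<omega>))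
        = expectation (\<lambda>\<omega>. measure_pmf.expectation D (?\<Phi> (\<lambda>j. S j \<omega>)))"
      unfolding apcd_Suc_eq_step by (rule expectation_next_sample[OF indep law loc])
    also have "\<dots> \<le> expectation (\<lambda>\<omega>. ?R k (?A k \<omega>))"
    proof (rule integral_mono)
      show "integrable M (\<lambda>\<omega>. measure_pmf.expectation D (?\<Phi> (\<lambda>j. S j \<omega>)))"
        by (rule int[of "\<lambda>a. measure_pmf.expectation D
              (\<lambda>s. energy b B f w u (theta k) (apcd_step b B f p v (theta k) a s))"])
      show "integrable M (\<lambda>\<omega>. ?R k (?A k \<omega>))"
        by (rule int)
      show "measure_pmf.expectation D (?\<Phi> (\<lambda>j. S j \<omega>)) \<le> ?R k (?A k \<omega>)" for \<omega>
        using expected_energy_step[OF B conv diff proper v eso theta_pos[of k] theta_le_1,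
            where x="fst (?A k \<omega>)" and z="snd (?A k \<omega>)" and u=u]
        by (simp add: p_def w_def)
    qed
    finally show ?thesis .
  qed
  show ?thesis
  proof (induction k)
    case 0
    then show ?case
      using step[of 0] by (simp add: prob_space)
  next
    case (Suc k)
    let ?t = "theta (Suc k)"
    have "?R (Suc k) s = (1 - ?t) * energy b B f w u (theta k) s" for s
      unfolding theta_Suc_sq energy_def by (simp add: algebra_simps)
    then have "expectation (\<lambda>\<omega>. energy b B f w u ?t (?A (Suc (Suc k)) \<omega>))
        \<le> (1 - ?t) * expectation (\<lambda>\<omega>. energy b B f w u (theta k) (?A (Suc k) \<omega>))"
      using step[of "Suc k"] by simp
    also have "\<dots> \<le> (1 - ?t) * (theta k ^ 2 / 2 * wnorm_sq b B w (x0 - u))"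
      using Suc theta_le_1[of "Suc k"] by (intro mult_left_mono) auto
    also have "\<dots> = ?t ^ 2 / 2 * wnorm_sq b B w (x0 - u)"
      unfolding theta_Suc_sq by simp
    finally show ?case .
  qed
qed

theorem corollary4:
  fixes b :: "'N::finite \<Rightarrow> 'n::finite"
    and B :: "'n \<Rightarrow> real^'N^'N"
    and f :: "real^'N \<Rightarrow> real"
    and D :: "'n set pmf"
    and v :: "real^'n"
    and x0 xs :: "real^'N"
    and M :: "'w measure"
    and S :: "nat \<Rightarrow> 'w \<Rightarrow> 'n set"
  assumes B: "\<And>i. block_pos_def b i (B i)"
    and convex: "convex_on UNIV f"
    and diff: "f differentiable_on UNIV"
    and proper: "proper_sampling D"
    and v: "\<And>i. v $ i > 0"
    and eso: "ESO b B f D v"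
    and opt: "\<And>x. f xs \<le> f x"
    and M: "prob_space M"
    and indep: "prob_space.indep_vars M (\<lambda>_. count_space UNIV) S UNIV"
    and law: "\<And>k. distr M (count_space UNIV) (S k) = measure_pmf D"
  shows "(\<forall>k\<ge>1. (\<integral>\<omega>. f (apcd_x b B f (sampling_prob D) v x0 (\<lambda>j. S j \<omega>) k) \<partial>M) - f xs
            \<le> 2 * wnorm_sq b B (v * vec_powi (sampling_prob D) (-2)) (x0 - xs) / (real k + 1)^2) \<and>
         (\<forall>\<epsilon>::real. \<epsilon> > 0 \<longrightarrow> (\<forall>k\<ge>1.
            real k \<ge> sqrt (2 * wnorm_sq b B (v * vec_powi (sampling_prob D) (-2)) (x0 - xs) / \<epsilon>) - 1 \<longrightarrow>
            (\<integral>\<omega>. f (apcd_x b B f (sampling_prob D) v x0 (\<lambda>j. S j \<omega>) k) \<partial>M) - f xs \<le> \<epsilon>))"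
proof -
  let ?p = "sampling_prob D"
  let ?w = "v * vec_powi ?p (-2)"
  let ?W = "wnorm_sq b B ?w (x0 - xs)"
  let ?A = "\<lambda>k \<omega>. apcd b B f ?p v x0 (\<lambda>j. S j \<omega>) k"
  interpret prob_space M by (rule M)
  note int = integrable_apcd[OF M indep]
  have "?w $ i \<ge> 0" for i
    using v[of i] by (simp add: vec_powi_def sampling_prob_def)
  then have nonneg: "wnorm_sq b B ?w x \<ge> 0" for x
    by (intro wnorm_sq_nonneg B)
  have bound: "(\<integral>\<omega>. f (apcd_x b B f ?p v x0 (\<lambda>j. S j \<omega>) k) \<partial>M) - f xs \<le> 2 * ?W / (real k + 1)^2"
    if "k \<ge> 1" for k
  proof -
    from that obtain m where k: "k = Suc m"
      by (cases k) auto
    have "(\<integral>\<omega>. f (apcd_x b B f ?p v x0 (\<lambda>j. S j \<omega>) k) \<partial>M) - f xs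
        = (\<integral>\<omega>. f (fst (?A k \<omega>)) - f xs \<partial>M)"
      unfolding apcd_x_def using int[of "\<lambda>a. f (fst a)"]
      by (simp add: Bochner_Integration.integral_diff prob_space)
    also have "\<dots> \<le> (\<integral>\<omega>. energy b B f ?w xs (theta m) (?A k \<omega>) \<partial>M)"
      using nonneg by (intro integral_mono int[of "\<lambda>a. f (fst a) - f xs"] int[of "energy b B f ?w xs (theta m)"])
        (simp add: energy_def)
    also have "\<dots> \<le> theta m ^ 2 / 2 * ?W"
      unfolding k by (rule expected_energy_le[OF B convex diff proper v eso M indep law])
    also have "\<dots> \<le> (2 / (real m + 2)) ^ 2 / 2 * ?W"
      using theta_le[of m] theta_pos[of m] nonneg by (intro mult_right_mono divide_right_mono power_mono) auto
    also have "\<dots> = 2 * ?W / (real k + 1)^2"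
      by (simp add: k power_divide add.commute)
    finally show ?thesis .
  qed
  moreover have "(\<integral>\<omega>. f (apcd_x b B f ?p v x0 (\<lambda>j. S j \<omega>) k) \<partial>M) - f xs \<le> \<epsilon>"
    if "\<epsilon> > 0" "k \<ge> 1" "real k \<ge> sqrt (2 * ?W / \<epsilon>) - 1" for \<epsilon> k
  proof -
    have "2 * ?W / \<epsilon> \<le> (real k + 1)^2"
      using that by (intro sqrt_le_D) simp
    then have "2 * ?W / (real k + 1)^2 \<le> \<epsilon>"
      using that by (simp add: field_simps)
    then show ?thesis
      using bound[OF that(2)] by linarith
  qed
  ultimately show ?thesis by blast
qed

end
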